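(* In the setting of the context, for all $a_1,\dots,a_n\in V$, \[ \Delta_I(a_1\cdots a_n)=\sum_{\substack{0\le k\le n\\0<j_1<\cdots<j_k\le n}}\ \mathop{⧢}_{p=0}^{k}I\big(a_{j_p};a_{j_p+1}\cdots a_{j_{p+1}-1};a_{j_{p+1}}\big)\otimes a_{j_1}\cdots a_{j_k}, \] where $j_0=0$, $j_{k+1}=n+1$, and one formally sets $a_0$ to be an element of $V\setminus V_0$ and $a_{n+1}$ an element of $V_0$ (only membership in $V_0$ matters in $I$).
   Context: $V=\{v_0,v_1,\dots\}$ with weight $\mathrm{wt}(v_0)=1$, $\mathrm{wt}(v_i)=i$; $V_0\subset V$. $\mathbb Q\langle V\rangle$: free associative algebra identified with $U(\mathrm{Lie}(V))$, shuffle coproduct $\Delta$ (letters primitive, Sweedler notation), antipode $S(a_1\cdots a_n)=(-1)^na_n\cdots a_1$, shuffle product $⧢$. For $t\in\mathrm{Lie}(V)$, $t\triangleright_I$ is the derivation of $\mathrm{Lie}(V)$ with $t\triangleright_Iv=0$ ($v\in V_0$), $t\triangleright_Iv=[v,t]$ ($v\notin V_0$), giving a post-Lie algebra; $\triangleright_I$ extends to $\mathbb Q\langle V\rangle^{\otimes2}$ by $x\triangleright\mathbf1=0$, $\mathbf1\triangleright A=A$, $xA\triangleright y=x\triangleright(A\triangleright y)-(x\triangleright A)\triangleright y$, $A\triangleright BC=(A_{(1)}\triangleright B)(A_{(2)}\triangleright C)$; $A\circledast_IB=A_{(1)}(A_{(2)}\triangleright_IB)$; $\Delta_I$ is dual to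 $\circledast_I$ w.r.t. the pairing making words orthonormal. For letters $v_i,v_j$ and $f\in\mathbb Q\langle V\rangle$: $I(v_i;f;v_j)=f$ if $(v_i,v_j)\in(V\setminus V_0)\times V_0$; $I(v_i;f;v_j)=S(f)$ if $(v_i,v_j)\in V_0\times(V\setminus V_0)$; $I(v_i;f;v_j)=(f\mid\mathbf 1)$ (constant term of $f$) if both are in $V\setminus V_0$ or both in $V_0$. *)

theory Defs
  imports Complex_Main "HOL-Library.Poly_Mapping" "HOL-Library.Product_Plus"
begin

text \<open>
  The letter \<open>v\<^sub>i\<close> is represented by \<open>i\<close>.  Lists form a monoid under concatenation, so the
  library's multiplication on finitely supported functions (the monoid algebra) makes
  \<open>letter list \<Rightarrow>\<^sub>0 rat\<close> the free associative algebra, with \<open>1\<close> the empty word, and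
  \<open>letter list \<times> letter list \<Rightarrow>\<^sub>0 rat\<close> its tensor square with the componentwise product.
\<close>

instantiation list :: (type) monoid_add
begin

definition zero_list :: "'a list" where "zero_list = []"
definition plus_list :: "'a list \<Rightarrow> 'a list \<Rightarrow> 'a list" where "plus_list = (@)"

instance by standard (simp_all add: zero_list_def plus_list_def)

end

type_synonym letter = nat
type_synonym alg = "letter list \<Rightarrow>\<^sub>0 rat"
type_synonym alg2 = "letter list \<times> letter list \<Rightarrow>\<^sub>0 rat"

definition word :: "letter list \<Rightarrow> alg" where
  "word w = Poly_Mapping.single w 1"

definition letter :: "letter \<Rightarrow> alg" where
  "letter v = word [v]"

definition smul :: "rat \<Rightarrow> ('k \<Rightarrow>\<^sub>0 rat) \<Rightarrow> ('k \<Rightarrow>\<^sub>0 rat)" where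
  "smul c f = Poly_Mapping.map ((*) c) f"

definition lin_ext :: "('k \<Rightarrow> ('l \<Rightarrow>\<^sub>0 rat)) \<Rightarrow> ('k \<Rightarrow>\<^sub>0 rat) \<Rightarrow> ('l \<Rightarrow>\<^sub>0 rat)" where
  "lin_ext g f = (\<Sum>w\<in>Poly_Mapping.keys f. smul (Poly_Mapping.lookup f w) (g w))"

definition pairing :: "('k \<Rightarrow>\<^sub>0 rat) \<Rightarrow> ('k \<Rightarrow>\<^sub>0 rat) \<Rightarrow> rat" where
  "pairing f g = (\<Sum>w\<in>Poly_Mapping.keys f. Poly_Mapping.lookup f w * Poly_Mapping.lookup g w)"

definition tensor :: "alg \<Rightarrow> alg \<Rightarrow> alg2" (infixr "\<otimes>" 72) where
  "f \<otimes> g = lin_ext (\<lambda>u. lin_ext (\<lambda>v. Poly_Mapping.single (u, v) 1) g) f"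

fun coproduct_word :: "letter list \<Rightarrow> alg2" where
  "coproduct_word [] = 1"
| "coproduct_word (a # w) = (letter a \<otimes> 1 + 1 \<otimes> letter a) * coproduct_word w"

definition coproduct :: "alg \<Rightarrow> alg2" where
  "coproduct = lin_ext coproduct_word"

text \<open>
  \<open>sweedler F A\<close> is \<open>F A\<^sub>1 A\<^sub>2\<close> in Sweedler notation (sum implied); it agrees with the usual meaning whenever
  \<open>F\<close> is bilinear.
\<close>
definition sweedler :: "(alg \<Rightarrow> alg \<Rightarrow> alg) \<Rightarrow> alg \<Rightarrow> alg" where
  "sweedler F A = lin_ext (\<lambda>(u, v). F (word u) (word v)) (coproduct A)"

definition antipode :: "alg \<Rightarrow> alg" where
  "antipode = lin_ext (\<lambda>w. smul ((- 1) ^ length w) (word (rev w)))"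

fun shuffle_word :: "letter list \<Rightarrow> letter list \<Rightarrow> alg" where
  "shuffle_word [] v = word v"
| "shuffle_word u [] = word u"
| "shuffle_word (a # u) (b # v) =
     letter a * shuffle_word u (b # v) + letter b * shuffle_word (a # u) v"

definition shuffle :: "alg \<Rightarrow> alg \<Rightarrow> alg" where
  "shuffle f g = lin_ext (\<lambda>u. lin_ext (shuffle_word u) g) f"

definition shuffle_list :: "alg list \<Rightarrow> alg" where
  "shuffle_list fs = foldr shuffle fs 1"

definition bracket :: "alg \<Rightarrow> alg \<Rightarrow> alg" where
  "bracket x y = x * y - y * x"

text \<open>The free Lie algebra, realised as the Lie subalgebra generated by the letters.\<close>
inductive_set Lie :: "alg set" where
  "letter v \<in> Lie"
| "x \<in> Lie \<Longrightarrow> y \<in> Lie \<Longrightarrow> x + y \<in> Lie"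
| "x \<in> Lie \<Longrightarrow> smul c x \<in> Lie"
| "x \<in> Lie \<Longrightarrow> y \<in> Lie \<Longrightarrow> bracket x y \<in> Lie"

text \<open>For every \<open>t\<close> in \<open>Lie\<close>, the restriction of \<open>T t\<close> to \<open>Lie\<close> is the derivation \<open>t \<triangleright>\<^sub>I\<close>.\<close>
definition is_Lie_action :: "letter set \<Rightarrow> (alg \<Rightarrow> alg \<Rightarrow> alg) \<Rightarrow> bool" where
  "is_Lie_action V0 T \<longleftrightarrow> (\<forall>t\<in>Lie.
     (\<forall>x\<in>Lie. T t x \<in> Lie) \<and>
     (\<forall>x\<in>Lie. \<forall>y\<in>Lie. T t (x + y) = T t x + T t y) \<and>
     (\<forall>c. \<forall>x\<in>Lie. T t (smul c x) = smul c (T t x)) \<and>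
     (\<forall>x\<in>Lie. \<forall>y\<in>Lie. T t (bracket x y) = bracket (T t x) y + bracket x (T t y)) \<and>
     (\<forall>v. T t (letter v) = (if v \<in> V0 then 0 else bracket (letter v) t)))"

definition is_enveloping_action :: "(alg \<Rightarrow> alg \<Rightarrow> alg) \<Rightarrow> bool" where
  "is_enveloping_action T \<longleftrightarrow>
     (\<forall>A. Vector_Spaces.linear smul smul (\<lambda>B. T A B)) \<and>
     (\<forall>B. Vector_Spaces.linear smul smul (\<lambda>A. T A B)) \<and>
     (\<forall>x\<in>Lie. T x 1 = 0) \<and>
     (\<forall>A. T 1 A = A) \<and>
     (\<forall>x\<in>Lie. \<forall>A. \<forall>y\<in>Lie. T (x * A) y = T x (T A y) - T (T x A) y) \<and>
     (\<forall>A B C. T A (B * C) = sweedler (\<lambda>A1 A2. T A1 B * T A2 C) A)"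

definition act :: "letter set \<Rightarrow> alg \<Rightarrow> alg \<Rightarrow> alg" where
  "act V0 = (THE T. is_Lie_action V0 T \<and> is_enveloping_action T)"

definition circled_ast :: "letter set \<Rightarrow> alg \<Rightarrow> alg \<Rightarrow> alg" where
  "circled_ast V0 A B = sweedler (\<lambda>A1 A2. A1 * act V0 A2 B) A"

definition Delta_I :: "letter set \<Rightarrow> alg \<Rightarrow> alg2" where
  "Delta_I V0 f = (THE d. \<forall>A B. pairing d (A \<otimes> B) = pairing f (circled_ast V0 A B))"

text \<open>
  The formal end points \<open>a\<^sub>0\<close> (outside \<open>V\<^sub>0\<close>) and \<open>a\<^sub>n\<^sub>+\<^sub>1\<close> (inside \<open>V\<^sub>0\<close>) are separate constructors,
  so that no assumption on \<open>V\<^sub>0\<close> or its complement being nonempty is needed.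
\<close>
datatype endpoint = Letter letter | Formal_outside | Formal_inside

fun in_V0 :: "letter set \<Rightarrow> endpoint \<Rightarrow> bool" where
  "in_V0 V0 (Letter v) \<longleftrightarrow> v \<in> V0"
| "in_V0 V0 Formal_outside \<longleftrightarrow> False"
| "in_V0 V0 Formal_inside \<longleftrightarrow> True"

definition I :: "letter set \<Rightarrow> endpoint \<Rightarrow> alg \<Rightarrow> endpoint \<Rightarrow> alg" where
  "I V0 p f q =
     (if \<not> in_V0 V0 p \<and> in_V0 V0 q then f
      else if in_V0 V0 p \<and> \<not> in_V0 V0 q then antipode f
      else smul (pairing f 1) 1)"

definition with_endpoints :: "nat \<Rightarrow> (nat \<Rightarrow> letter) \<Rightarrow> nat \<Rightarrow> endpoint" where
  "with_endpoints n a i =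
     (if i = 0 then Formal_outside else if i = n + 1 then Formal_inside else Letter (a i))"

definition index_seqs :: "nat \<Rightarrow> nat \<Rightarrow> nat list set" where
  "index_seqs n k = {js. length js = k \<and> sorted_wrt (<) js \<and> set js \<subseteq> {1..n}}"

text \<open>\<open>j\<^sub>p\<close> for \<open>0 \<le> p \<le> k + 1\<close>, where \<open>j\<^sub>0 = 0\<close> and \<open>j\<^sub>k\<^sub>+\<^sub>1 = n + 1\<close>.\<close>
definition idx :: "nat \<Rightarrow> nat list \<Rightarrow> nat \<Rightarrow> nat" where
  "idx n js p = (0 # js @ [n + 1]) ! p"

text \<open>The word \<open>a\<^sub>l a\<^sub>l\<^sub>+\<^sub>1 \<dots> a\<^sub>m\<^sub>-\<^sub>1\<close>.\<close>
definition segment :: "(nat \<Rightarrow> letter) \<Rightarrow> nat \<Rightarrow> nat \<Rightarrow> alg" where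
  "segment a l m = word (map a [l..<m])"

end

theory Submission
  imports Defs
begin

text \<open>
  The action is explicit: an element \<open>A\<close> sends a letter \<open>v \<notin> V\<^sub>0\<close> to \<open>S(A\<^sub>1) v A\<^sub>2\<close> and a letter
  \<open>v \<in> V\<^sub>0\<close> to the counit of \<open>A\<close> times \<open>v\<close>, and it is distributed over products by the coproduct.
  Consequently \<open>u \<circledast>\<^sub>I v\<^sub>1\<dots>v\<^sub>k\<close> is obtained by splitting \<open>u\<close> into pieces placed to the left and right of
  the letters \<open>v\<^sub>i\<close>.  Between two consecutive letters the pieces combine, by the antipode axiom and
  cocommutativity, to one piece on which \<open>I(v\<^sub>i; _; v\<^sub>i\<^sub>+\<^sub>1)\<close> is evaluated.  The formula for \<open>\<Delta>\<^sub>I\<close> is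
  the transpose of this one, because the maps \<open>I(v\<^sub>i; _; v\<^sub>i\<^sub>+\<^sub>1)\<close> are self-adjoint and the shuffle
  product is dual to the coproduct.
\<close>

section \<open>Linear and bilinear maps\<close>

lemma lookup_smul [simp]: "Poly_Mapping.lookup (smul c f) k = c * Poly_Mapping.lookup f k"
  unfolding smul_def by (simp add: Poly_Mapping.map.rep_eq when_def)

lemma smul_simps [simp]:
  "smul c 0 = 0" "smul 0 f = 0" "smul 1 f = f" "smul c (smul d f) = smul (c * d) f"
  "smul (- 1) f = - f" "smul c (Poly_Mapping.single k d) = Poly_Mapping.single k (c * d)"
  by (auto intro!: poly_mapping_eqI simp: lookup_single when_def)

lemma smul_add: "smul c (f + g) = smul c f + smul c g"
  and smul_add_left: "smul (c + d) f = smul c f + smul d f"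
  and smul_diff: "smul c (f - g) = smul c f - smul c g"
  and smul_minus: "smul c (- f) = - smul c f"
  by (auto intro!: poly_mapping_eqI simp: lookup_add lookup_minus algebra_simps)

lemma smul_sum: "smul c (\<Sum>i\<in>S. f i) = (\<Sum>i\<in>S. smul c (f i))"
  by (induction S rule: infinite_finite_induct) (auto simp: smul_add)

lemma sum_singles:
  "(\<Sum>k\<in>Poly_Mapping.keys f. Poly_Mapping.single k (Poly_Mapping.lookup f k)) = f"
  by (rule poly_mapping_eqI)
    (auto simp: lookup_sum lookup_single when_def in_keys_iff sum.delta cong: if_cong)

text \<open>Scalars sit in the monoid algebra as multiples of its unit; this reduces compatibility
  of \<open>smul\<close> with products to associativity and centrality of these elements.\<close>

lemma smul_eq_mult: "smul c (f :: 'a :: monoid_add \<Rightarrow>\<^sub>0 rat) = Poly_Mapping.single 0 c * f"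
proof -
  have "smul c f = (\<Sum>k\<in>Poly_Mapping.keys f. Poly_Mapping.single k (c * Poly_Mapping.lookup f k))"
    by (rule poly_mapping_eqI)
      (auto simp: lookup_sum lookup_single when_def in_keys_iff if_distrib sum.delta cong: if_cong)
  also have "\<dots> = Poly_Mapping.single 0 c *
      (\<Sum>k\<in>Poly_Mapping.keys f. Poly_Mapping.single k (Poly_Mapping.lookup f k))"
    by (simp add: sum_distrib_left mult_single)
  also have "(\<Sum>k\<in>Poly_Mapping.keys f. Poly_Mapping.single k (Poly_Mapping.lookup f k)) = f"
    by (rule sum_singles)
  finally show ?thesis .
qed

lemma mult_smul_left [simp]: "smul c f * (g :: 'a :: monoid_add \<Rightarrow>\<^sub>0 rat) = smul c (f * g)"
  by (simp add: smul_eq_mult mult.assoc)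

lemma single_zero_commutes:
  "Poly_Mapping.single 0 c * (f :: 'a :: monoid_add \<Rightarrow>\<^sub>0 rat) = f * Poly_Mapping.single 0 c"
proof -
  have "Poly_Mapping.single 0 c * (\<Sum>k\<in>Poly_Mapping.keys f. Poly_Mapping.single k (Poly_Mapping.lookup f k)) =
      (\<Sum>k\<in>Poly_Mapping.keys f. Poly_Mapping.single k (Poly_Mapping.lookup f k)) * Poly_Mapping.single 0 c"
    by (simp add: sum_distrib_left sum_distrib_right mult_single mult.commute)
  then show ?thesis by (simp add: sum_singles)
qed

lemma mult_smul_right [simp]: "f * smul c (g :: 'a :: monoid_add \<Rightarrow>\<^sub>0 rat) = smul c (f * g)"
  by (metis single_zero_commutes smul_eq_mult mult.assoc)

text \<open>A locale-free form of linearity, suited to syntax-directed proofs by the rules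
  \<open>lin_intros\<close>; \<open>linear_iff_lin\<close> identifies it with the predicate
  occurring in \<open>is_enveloping_action\<close>.\<close>

definition lin :: "(('k \<Rightarrow>\<^sub>0 rat) \<Rightarrow> ('l \<Rightarrow>\<^sub>0 rat)) \<Rightarrow> bool" where
  "lin F \<longleftrightarrow> (\<forall>x y. F (x + y) = F x + F y) \<and> (\<forall>c x. F (smul c x) = smul c (F x))"

lemma linI:
  "(\<And>x y. F (x + y) = F x + F y) \<Longrightarrow> (\<And>c x. F (smul c x) = smul c (F x)) \<Longrightarrow> lin F"
  by (simp add: lin_def)

lemma lin_add: "lin F \<Longrightarrow> F (x + y) = F x + F y"
  and lin_smul: "lin F \<Longrightarrow> F (smul c x) = smul c (F x)"
  by (simp_all add: lin_def)

lemma lin_zero: "lin F \<Longrightarrow> F 0 = 0"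
  using lin_smul[of F 0 0] by simp

lemma lin_uminus: "lin F \<Longrightarrow> F (- x) = - F x"
  using lin_smul[of F "- 1" x] by simp

lemma lin_diff: "lin F \<Longrightarrow> F (x - y) = F x - F y"
  using lin_add[of F x "- y"] by (simp add: lin_uminus)

lemma lin_sum: "lin F \<Longrightarrow> F (\<Sum>i\<in>S. f i) = (\<Sum>i\<in>S. F (f i))"
  by (induction S rule: infinite_finite_induct) (auto simp: lin_add lin_zero)

lemma vector_space_smul: "vector_space (smul :: rat \<Rightarrow> ('k \<Rightarrow>\<^sub>0 rat) \<Rightarrow> _)"
  by unfold_locales (simp_all add: smul_add smul_add_left)

lemma linear_iff_lin: "Vector_Spaces.linear smul smul F \<longleftrightarrow> lin F"
  by (auto simp: Vector_Spaces.linear_iff lin_def vector_space_smul)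

lemma lin_ext_superset:
  assumes "finite S" "Poly_Mapping.keys f \<subseteq> S"
  shows "lin_ext g f = (\<Sum>w\<in>S. smul (Poly_Mapping.lookup f w) (g w))"
  unfolding lin_ext_def using assms
  by (intro sum.mono_neutral_left) (auto simp: in_keys_iff)

lemma lin_lin_ext: "lin (lin_ext g)"
proof (rule linI)
  fix x y :: "'a \<Rightarrow>\<^sub>0 rat" and c :: rat
  let ?S = "Poly_Mapping.keys x \<union> Poly_Mapping.keys y"
  show "lin_ext g (x + y) = lin_ext g x + lin_ext g y"
    using Poly_Mapping.keys_add[of x y]
    by (simp add: lin_ext_superset[of ?S] lookup_add smul_add_left sum.distrib)
  have "Poly_Mapping.keys (smul c x) \<subseteq> Poly_Mapping.keys x"
    by (auto simp: in_keys_iff)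
  then show "lin_ext g (smul c x) = smul c (lin_ext g x)"
    by (simp add: lin_ext_superset[of "Poly_Mapping.keys x"] smul_sum)
qed

lemma lin_ext_single [simp]: "lin_ext g (Poly_Mapping.single w c) = smul c (g w)"
  by (simp add: lin_ext_superset[of "{w}"])

lemma lin_ext_word [simp]: "lin_ext g (word w) = g w"
  by (simp add: word_def)

lemma lin_eq_basis:
  assumes "lin F" "lin G" "\<And>w. F (Poly_Mapping.single w 1) = G (Poly_Mapping.single w 1)"
  shows "F x = G x"
proof -
  have x: "x = (\<Sum>k\<in>Poly_Mapping.keys x. smul (Poly_Mapping.lookup x k) (Poly_Mapping.single k 1))"
    by (simp add: sum_singles)
  show ?thesis
    by (subst (1 2) x) (simp only: assms lin_sum lin_smul)
qed

text \<open>The standard reduction below: an identity linear in an argument is tested on words,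
  where induction is available.\<close>

lemma lin_eq_words:
  assumes "lin F" "lin G" "\<And>w. F (word w) = G (word w)"
  shows "F x = G x"
  using lin_eq_basis assms unfolding word_def by blast

lemma word_Nil: "word [] = 1"
  by (simp add: word_def zero_list_def[symmetric])

lemma word_append: "word (u @ v) = word u * word v"
  by (simp add: word_def mult_single plus_list_def)

lemma word_Cons: "word (a # w) = letter a * word w"
  using word_append[of "[a]" w] by (simp add: letter_def)

named_theorems lin_intros

lemma lin_id [lin_intros]: "lin (\<lambda>x. x)"
  and lin_const_zero [lin_intros]: "lin (\<lambda>x. 0)"
  and lin_plus [lin_intros]: "lin F \<Longrightarrow> lin G \<Longrightarrow> lin (\<lambda>x. F x + G x)"
  and lin_minus [lin_intros]: "lin F \<Longrightarrow> lin G \<Longrightarrow> lin (\<lambda>x. F x - G x)"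
  and lin_scale [lin_intros]: "lin F \<Longrightarrow> lin (\<lambda>x. smul c (F x))"
  by (auto simp: lin_def smul_add smul_diff smul_minus mult.commute)

lemma lin_mult_left [lin_intros]: "lin F \<Longrightarrow> lin (\<lambda>x. h * F x)"
  and lin_mult_right [lin_intros]: "lin F \<Longrightarrow> lin (\<lambda>x. F x * h)"
  for h :: "'a :: monoid_add \<Rightarrow>\<^sub>0 rat"
  by (auto simp: lin_def algebra_simps)

lemma lin_lookup [lin_intros]: "lin F \<Longrightarrow> lin (\<lambda>x. smul (Poly_Mapping.lookup (F x) k) h)"
  by (auto simp: lin_def lookup_add smul_add_left)

lemma lin_compose_lin_ext [lin_intros]: "lin F \<Longrightarrow> lin (\<lambda>x. lin_ext g (F x))"
  using lin_lin_ext[of g] by (auto simp: lin_def)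

lemma lin_lin_ext_fun [lin_intros]:
  assumes "\<And>k. lin (\<lambda>x. h x k)"
  shows "lin (\<lambda>x. lin_ext (h x) f)"
proof (rule linI)
  fix x y c
  show "lin_ext (h (x + y)) f = lin_ext (h x) f + lin_ext (h y) f"
    using lin_add[OF assms] by (simp add: lin_ext_def smul_add sum.distrib)
  show "lin_ext (h (smul c x)) f = smul c (lin_ext (h x) f)"
    using lin_smul[OF assms] by (simp add: lin_ext_def smul_sum mult.commute)
qed

lemma lin_compose: "lin F \<Longrightarrow> lin G \<Longrightarrow> lin (\<lambda>x. F (G x))"
  by (auto simp: lin_def)

text \<open>\<open>sweedler\<close> evaluates its function argument only on pairs of words;
  bilinearity lets such pairs be replaced by general elements.\<close>

definition bilin :: "(('j \<Rightarrow>\<^sub>0 rat) \<Rightarrow> ('k \<Rightarrow>\<^sub>0 rat) \<Rightarrow> ('l \<Rightarrow>\<^sub>0 rat)) \<Rightarrow> bool" where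
  "bilin F \<longleftrightarrow> (\<forall>q. lin (\<lambda>p. F p q)) \<and> (\<forall>p. lin (\<lambda>q. F p q))"

lemma bilinI [lin_intros]: "(\<And>q. lin (\<lambda>p. F p q)) \<Longrightarrow> (\<And>p. lin (\<lambda>q. F p q)) \<Longrightarrow> bilin F"
  by (simp add: bilin_def)

lemma bilin_left: "bilin F \<Longrightarrow> lin G \<Longrightarrow> lin (\<lambda>x. F (G x) q)"
  and bilin_right: "bilin F \<Longrightarrow> lin G \<Longrightarrow> lin (\<lambda>x. F p (G x))"
  by (auto simp: bilin_def lin_def)

section \<open>Sweedler calculus\<close>

text \<open>Each letter is sent to one of two complementary subwords. A list rather than a set keeps
  the multiplicities that arise when letters repeat.\<close>

fun splits :: "'a list \<Rightarrow> ('a list \<times> 'a list) list" where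
  "splits [] = [([], [])]"
| "splits (a # w) = map (\<lambda>(u, v). (a # u, v)) (splits w) @ map (\<lambda>(u, v). (u, a # v)) (splits w)"

lemma splits_length: "(u, v) \<in> set (splits w) \<Longrightarrow> length u + length v = length w"
  by (induction w arbitrary: u v) auto

lemma tensor_words [simp]: "word u \<otimes> word v = Poly_Mapping.single (u, v) 1"
  by (simp add: tensor_def)

lemma letter_eq_word: "letter a = word [a]" "1 = word []"
  by (simp_all add: letter_def word_Nil)

lemma lin_sum_list: "lin F \<Longrightarrow> F (\<Sum>i\<leftarrow>l. f i) = (\<Sum>i\<leftarrow>l. F (f i))"
  by (induction l) (auto simp: lin_add lin_zero)

text \<open>Expanding the product of the factors
  \<open>letter a \<otimes> 1 + 1 \<otimes> letter a\<close> means choosing a tensor factor for each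
  letter, which is the recursion of \<open>splits\<close>.\<close>

lemma coproduct_word_splits: "coproduct_word w = (\<Sum>p\<leftarrow>splits w. Poly_Mapping.single p 1)"
proof (induction w)
  case Nil
  then show ?case
    by (metis coproduct_word.simps(1) splits.simps(1) list.map(1,2) sum_list_simps add_0_right
        single_one zero_prod_def zero_list_def)
next
  case (Cons a w)
  have "(letter a \<otimes> 1) * (\<Sum>p\<leftarrow>l. Poly_Mapping.single p 1) =
      (\<Sum>(u, v)\<leftarrow>l. Poly_Mapping.single (a # u, v) 1)"
    "(1 \<otimes> letter a) * (\<Sum>p\<leftarrow>l. Poly_Mapping.single p 1) =
      (\<Sum>(u, v)\<leftarrow>l. Poly_Mapping.single (u, a # v) 1)" for l
    by (induction l)
      (auto simp: letter_eq_word distrib_left mult_single plus_prod_def plus_list_def)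
  then show ?case
    using Cons by (simp add: distrib_right case_prod_beta' o_def)
qed

lemma sweedler_word: "sweedler F (word w) = (\<Sum>(u, v)\<leftarrow>splits w. F (word u) (word v))"
  unfolding sweedler_def coproduct_def
  by (simp add: coproduct_word_splits lin_sum_list[OF lin_lin_ext] case_prod_beta')

lemma lin_sweedler [lin_intros]: "lin G \<Longrightarrow> lin (\<lambda>x. sweedler F (G x))"
  unfolding sweedler_def coproduct_def by (intro lin_intros)

lemma lin_sweedler_fun [lin_intros]:
  "(\<And>p q. lin (\<lambda>x. F x p q)) \<Longrightarrow> lin (\<lambda>x. sweedler (F x) A)"
  unfolding sweedler_def case_prod_beta' by (intro lin_intros)

lemma sweedler_add: "sweedler F (A + B) = sweedler F A + sweedler F B"
  and sweedler_diff: "sweedler F (A - B) = sweedler F A - sweedler F B"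
  and sweedler_smul: "sweedler F (smul c A) = smul c (sweedler F A)"
  using lin_sweedler[OF lin_id, of F] by (simp_all add: lin_add lin_smul lin_diff)

lemma sweedler_plus: "sweedler (\<lambda>p q. F p q + G p q) A = sweedler F A + sweedler G A"
  by (simp add: sweedler_def lin_ext_def case_prod_beta' smul_add sum.distrib)

lemma sweedler_minus: "sweedler (\<lambda>p q. F p q - G p q) A = sweedler F A - sweedler G A"
  by (simp add: sweedler_def lin_ext_def case_prod_beta' smul_diff sum_subtractf)

lemma lin_of_sweedler: "lin h \<Longrightarrow> h (sweedler F A) = sweedler (\<lambda>p q. h (F p q)) A"
  by (simp add: sweedler_def lin_ext_def lin_sum lin_smul case_prod_beta')

lemma sweedler_mult_left: "h * sweedler F A = sweedler (\<lambda>p q. h * F p q) A"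
  and sweedler_mult_right: "sweedler F A * h = sweedler (\<lambda>p q. F p q * h) A"
  by (rule lin_of_sweedler, intro lin_intros)+

lemma sweedler_one: "sweedler F 1 = F 1 1"
  using sweedler_word[of F "[]"] by (simp add: word_Nil)

lemma sweedler_word_Cons:
  "sweedler F (word (a # w)) =
     sweedler (\<lambda>p q. F (letter a * p) q + F p (letter a * q)) (word w)"
  unfolding sweedler_word by (simp add: sum_list_addf case_prod_beta' o_def word_Cons)

text \<open>Exchanging the components only swaps the two destinations of each letter;
  \<open>F\<close> is generalised because the recursion changes it.\<close>

lemma sweedler_cocommute: "sweedler F A = sweedler (\<lambda>p q. F q p) A"
proof (rule lin_eq_words[of "\<lambda>A. sweedler F A" "\<lambda>A. sweedler (\<lambda>p q. F q p) A"])
  show "sweedler F (word w) = sweedler (\<lambda>p q. F q p) (word w)" for w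
  proof (induction w arbitrary: F)
    case (Cons a w)
    show ?case
      unfolding sweedler_word_Cons sweedler_plus
      by (subst (1 2) Cons) (rule add.commute)
  qed (simp add: word_Nil sweedler_one)
qed (intro lin_intros)+

text \<open>Both sides distribute the letters over three subwords; the three instances of the
  induction hypothesis are the three destinations of the first letter.\<close>

lemma splits_coassoc:
  fixes g :: "_ \<Rightarrow> _ \<Rightarrow> _ \<Rightarrow> 'b :: comm_monoid_add"
  shows "(\<Sum>(u, v)\<leftarrow>splits w. \<Sum>(v1, v2)\<leftarrow>splits v. g u v1 v2) =
    (\<Sum>(u, v)\<leftarrow>splits w. \<Sum>(u1, u2)\<leftarrow>splits u. g u1 u2 v)"
proof (induction w arbitrary: g)
  case (Cons a w)
  show ?case
    using Cons[of "\<lambda>u. g (a # u)"] Cons[of "\<lambda>u v. g u (a # v)"] Cons[of "\<lambda>u v1 v2. g u v1 (a # v2)"]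
    by (simp add: case_prod_beta' o_def sum_list_addf add.assoc)
qed simp

lemma sweedler_coassoc:
  "sweedler (\<lambda>p q. sweedler (G p) q) A = sweedler (\<lambda>p q. sweedler (\<lambda>p1 p2. G p1 p2 q) p) A"
proof (rule lin_eq_words[of "\<lambda>A. sweedler (\<lambda>p q. sweedler (G p) q) A"
      "\<lambda>A. sweedler (\<lambda>p q. sweedler (\<lambda>p1 p2. G p1 p2 q) p) A"])
  show "sweedler (\<lambda>p q. sweedler (G p) q) (word w) =
      sweedler (\<lambda>p q. sweedler (\<lambda>p1 p2. G p1 p2 q) p) (word w)" for w
    unfolding sweedler_word by (rule splits_coassoc)
qed (intro lin_intros)+

section \<open>Counit, antipode and primitive elements\<close>

definition counit :: "alg \<Rightarrow> rat" where
  "counit A = Poly_Mapping.lookup A []"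

lemma lin_counit [lin_intros]: "lin F \<Longrightarrow> lin (\<lambda>x. smul (counit (F x)) h)"
  unfolding counit_def by (intro lin_intros)

lemma counit_word [simp]: "counit (word w) = (if w = [] then 1 else 0)"
  by (simp add: counit_def word_def lookup_single when_def)

lemma counit_simps [simp]:
  "counit 1 = 1" "counit 0 = 0" "counit (letter a) = 0" "counit (A + B) = counit A + counit B"
  "counit (A - B) = counit A - counit B" "counit (smul c A) = c * counit A"
  using counit_word[of "[]"]
  by (simp_all add: letter_eq_word del: counit_word)
    (simp_all add: counit_def lookup_add lookup_minus word_def lookup_single)

lemma counit_mult [simp]: "counit (A * B) = counit A * counit B"
proof -
  \<comment> \<open>\<open>lin_eq_words\<close> compares maps into finitely supported functions, so
    the scalar identity is first multiplied by the unit and then recovered by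
    \<open>counit\<close>.\<close>
  have "smul (counit (A * B)) (1 :: alg) = smul (counit A) (smul (counit B) 1)"
  proof (rule lin_eq_words[of "\<lambda>A. smul (counit (A * B)) 1" "\<lambda>A. smul (counit A) (smul (counit B) 1)"])
    show "smul (counit (word u * B)) (1 :: alg) = smul (counit (word u)) (smul (counit B) 1)" for u
      by (rule lin_eq_words[of "\<lambda>B. smul (counit (word u * B)) 1"
            "\<lambda>B. smul (counit (word u)) (smul (counit B) 1)"]; (intro lin_intros)?)
        (simp add: word_append[symmetric])
  qed (intro lin_intros)+
  from arg_cong[OF this, of counit] show ?thesis by simp
qed

lemma lin_antipode [lin_intros]: "lin F \<Longrightarrow> lin (\<lambda>x. antipode (F x))"
  unfolding antipode_def by (intro lin_intros)

lemma antipode_word: "antipode (word w) = smul ((- 1) ^ length w) (word (rev w))"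
  by (simp add: antipode_def)

lemma antipode_one [simp]: "antipode 1 = 1"
  using antipode_word[of "[]"] by (simp add: word_Nil)

lemma antipode_letter [simp]: "antipode (letter a) = - letter a"
  by (simp add: letter_eq_word antipode_word)

lemma antipode_mult: "antipode (A * B) = antipode B * antipode A"
proof (rule lin_eq_words[of "\<lambda>A. antipode (A * B)" "\<lambda>A. antipode B * antipode A"])
  show "antipode (word u * B) = antipode B * antipode (word u)" for u
    by (rule lin_eq_words[of "\<lambda>B. antipode (word u * B)" "\<lambda>B. antipode B * antipode (word u)"]; (intro lin_intros)?)
      (simp add: word_append[symmetric] antipode_word power_add mult.commute)
qed (intro lin_intros)+

lemma antipode_linear:
  "antipode (A + B) = antipode A + antipode B" "antipode (A - B) = antipode A - antipode B"
  "antipode (smul c A) = smul c (antipode A)" "antipode (- A) = - antipode A" "antipode 0 = 0"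
  using lin_antipode[OF lin_id] by (auto simp: lin_add lin_diff lin_smul lin_uminus lin_zero)

lemma sweedler_counit_left:
  assumes "lin F"
  shows "sweedler (\<lambda>p q. smul (counit p) (F q)) A = F A"
proof (rule lin_eq_words[of "\<lambda>A. sweedler (\<lambda>p q. smul (counit p) (F q)) A" F])
  show "sweedler (\<lambda>p q. smul (counit p) (F q)) (word w) = F (word w)" for w
    using assms
  proof (induction w arbitrary: F)
    case (Cons a w)
    have "lin (\<lambda>q. F (letter a * q))"
      by (rule lin_compose[OF Cons.prems]) (intro lin_intros)
    from Cons.IH[OF this] show ?case
      unfolding sweedler_word_Cons by (simp add: word_Cons)
  qed (simp add: word_Nil sweedler_one)
qed (intro assms lin_intros)+

lemma sweedler_counit_right:
  assumes "lin F"
  shows "sweedler (\<lambda>p q. smul (counit q) (F p)) A = F A"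
  using sweedler_counit_left[OF assms, of A] by (subst sweedler_cocommute)

lemma sweedler_antipode: "sweedler (\<lambda>p q. p * antipode q) A = smul (counit A) 1"
proof (rule lin_eq_words[of "\<lambda>A. sweedler (\<lambda>p q. p * antipode q) A" "\<lambda>A. smul (counit A) 1"])
  show "sweedler (\<lambda>p q. p * antipode q) (word w) = smul (counit (word w)) 1" for w
  proof (induction w)
    case (Cons a w)
    \<comment> \<open>The two destinations of \<open>a\<close> give the commutator of
      \<open>letter a\<close> with the sum for \<open>w\<close>; that sum is a scalar by induction,
      so the commutator vanishes.\<close>
    have "sweedler (\<lambda>p q. p * antipode q) (word (a # w)) =
        letter a * sweedler (\<lambda>p q. p * antipode q) (word w) -
        sweedler (\<lambda>p q. p * antipode q) (word w) * letter a"
      unfolding sweedler_word_Cons sweedler_mult_left sweedler_mult_right sweedler_minus[symmetric]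
      by (simp add: antipode_mult mult.assoc)
    then show ?case by (simp add: Cons)
  qed (simp add: word_Nil sweedler_one)
qed (intro lin_intros)+

text \<open>The identity \<Delta>(xB) = (x \<otimes> 1 + 1 \<otimes> x)\<Delta>(B), tested against
  bilinear maps so that tensors do not enter. Keeping the factor \<open>B\<close> allows Lie
  elements to be peeled off a product one at a time.\<close>

definition primitive :: "alg \<Rightarrow> bool" where
  "primitive x \<longleftrightarrow> (\<forall>F B. bilin F \<longrightarrow>
     sweedler F (x * B) = sweedler (\<lambda>p q. F (x * p) q + F p (x * q)) B)"

lemma primitiveD:
  "primitive x \<Longrightarrow> bilin F \<Longrightarrow>
    sweedler F (x * B) = sweedler (\<lambda>p q. F (x * p) q + F p (x * q)) B"
  by (simp add: primitive_def)

lemma bilin_mult_args [lin_intros]: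
  "bilin F \<Longrightarrow> bilin (\<lambda>p q. F (x * p) q)" "bilin F \<Longrightarrow> bilin (\<lambda>p q. F p (x * q))"
  for x :: alg
  by (auto simp: bilin_def lin_def algebra_simps)

lemma bilin_plus [lin_intros]: "bilin F \<Longrightarrow> bilin G \<Longrightarrow> bilin (\<lambda>p q. F p q + G p q)"
  by (auto simp: bilin_def intro: lin_intros)

lemma primitive_letter: "primitive (letter a)"
  unfolding primitive_def
proof (intro allI impI)
  fix F :: "alg \<Rightarrow> alg \<Rightarrow> alg" and B
  assume "bilin F"
  show "sweedler F (letter a * B) = sweedler (\<lambda>p q. F (letter a * p) q + F p (letter a * q)) B"
    by (rule lin_eq_words[of "\<lambda>B. sweedler F (letter a * B)"]; (intro lin_intros)?)
      (simp add: word_Cons[symmetric] sweedler_word_Cons)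
qed

lemma bilin_linear:
  assumes "bilin F"
  shows "F (x + y) q = F x q + F y q" "F p (x + y) = F p x + F p y"
    "F (x - y) q = F x q - F y q" "F p (x - y) = F p x - F p y"
    "F (smul c x) q = smul c (F x q)" "F p (smul c x) = smul c (F p x)"
    "F 0 q = 0" "F p 0 = 0"
  using assms lin_add[of "\<lambda>p. F p q"] lin_add[of "F p"] lin_diff[of "\<lambda>p. F p q"] lin_diff[of "F p"]
    lin_smul[of "\<lambda>p. F p q"] lin_smul[of "F p"] lin_zero[of "\<lambda>p. F p q"] lin_zero[of "F p"]
  by (auto simp: bilin_def)

lemma primitive_plus: "primitive x \<Longrightarrow> primitive y \<Longrightarrow> primitive (x + y)"
  by (auto simp: primitive_def distrib_right sweedler_add bilin_linear sweedler_plus)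

lemma sweedler_smul_fun: "sweedler (\<lambda>p q. smul c (F p q)) A = smul c (sweedler F A)"
  by (rule lin_of_sweedler[symmetric]) (intro lin_intros)

lemma primitive_smul: "primitive x \<Longrightarrow> primitive (smul c x)"
  by (auto simp: primitive_def sweedler_smul bilin_linear sweedler_plus sweedler_smul_fun smul_add)

lemma primitive_bracket:
  assumes "primitive x" "primitive y"
  shows "primitive (bracket x y)"
  unfolding primitive_def
proof (intro allI impI)
  fix F :: "alg \<Rightarrow> alg \<Rightarrow> alg" and B
  assume F: "bilin F"
  \<comment> \<open>The mixed terms, with \<open>x\<close> and \<open>y\<close> on different sides,
    are symmetric in \<open>x\<close> and \<open>y\<close> and therefore cancel in the
    commutator.\<close>
  have *: "sweedler F (x * (y * B)) = sweedler (\<lambda>p q. F (x * (y * p)) q + F (x * p) (y * q)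
      + F (y * p) (x * q) + F p (x * (y * q))) B" if "primitive x" "primitive y" for x y
    using that F by (simp add: primitiveD lin_intros add_ac)
  show "sweedler F (bracket x y * B) =
      sweedler (\<lambda>p q. F (bracket x y * p) q + F p (bracket x y * q)) B"
    using assms F
    by (simp add: bracket_def left_diff_distrib mult.assoc sweedler_diff * bilin_linear
        sweedler_minus[symmetric] algebra_simps)
qed

lemma primitive_Lie: "x \<in> Lie \<Longrightarrow> primitive x"
  by (induction rule: Lie.induct)
    (auto intro: primitive_letter primitive_plus primitive_smul primitive_bracket)

lemma sweedler_primitive:
  assumes "primitive x" "bilin F"
  shows "sweedler F x = F x 1 + F 1 x"
  using primitiveD[OF assms, of 1] by (simp add: sweedler_one)

lemma antipode_Lie: "x \<in> Lie \<Longrightarrow> antipode x = - x"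
  by (induction rule: Lie.induct)
    (auto simp: antipode_linear smul_minus bracket_def antipode_mult)

lemma counit_Lie [simp]: "x \<in> Lie \<Longrightarrow> counit x = 0"
  by (induction rule: Lie.induct) (auto simp: bracket_def)

lemma Lie_zero: "0 \<in> Lie"
  using Lie.intros(3)[OF Lie.intros(1), of 0] by simp

section \<open>The action of the enveloping algebra\<close>

text \<open>The second case is the right adjoint action: for \<open>A\<close> in \<open>Lie\<close>
  the antipode supplies the minus sign and the sum becomes
  \<open>bracket (letter b) A\<close>.\<close>

definition letter_action :: "letter set \<Rightarrow> alg \<Rightarrow> letter \<Rightarrow> alg" where
  "letter_action V0 A b =
     (if b \<in> V0 then smul (counit A) (letter b)
      else sweedler (\<lambda>p q. antipode p * letter b * q) A)"

primrec word_action :: "letter set \<Rightarrow> alg \<Rightarrow> letter list \<Rightarrow> alg" where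
  "word_action V0 A [] = smul (counit A) 1"
| "word_action V0 A (b # w) = sweedler (\<lambda>p q. letter_action V0 p b * word_action V0 q w) A"

definition action :: "letter set \<Rightarrow> alg \<Rightarrow> alg \<Rightarrow> alg" where
  "action V0 A = lin_ext (word_action V0 A)"

lemma lin_letter_action [lin_intros]: "lin F \<Longrightarrow> lin (\<lambda>x. letter_action V0 (F x) b)"
  unfolding letter_action_def by (cases "b \<in> V0") (simp_all add: lin_intros)

lemma lin_word_action [lin_intros]: "lin F \<Longrightarrow> lin (\<lambda>x. word_action V0 (F x) w)"
  by (cases w) (simp_all add: lin_intros)

lemma lin_action [lin_intros]:
  "lin F \<Longrightarrow> lin (\<lambda>x. action V0 (F x) B)" "lin F \<Longrightarrow> lin (\<lambda>x. action V0 A (F x))"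
  unfolding action_def by (intro lin_intros; assumption)+

lemma action_linear:
  "action V0 (A + A') B = action V0 A B + action V0 A' B"
  "action V0 (smul c A) B = smul c (action V0 A B)"
  "action V0 A (B + B') = action V0 A B + action V0 A B'"
  "action V0 A (B - B') = action V0 A B - action V0 A B'"
  "action V0 A (smul c B) = smul c (action V0 A B)"
  "action V0 A (- B) = - action V0 A B"
  "action V0 A 0 = 0"
  using lin_action(1)[OF lin_id, of V0 B] lin_action(2)[OF lin_id, of V0 A]
  by (simp_all add: lin_def)
    (simp_all add: lin_diff[OF lin_action(2)[OF lin_id]] lin_uminus[OF lin_action(2)[OF lin_id]]
      lin_zero[OF lin_action(2)[OF lin_id]])

lemma action_word: "action V0 A (word w) = word_action V0 A w"
  by (simp add: action_def)

lemma action_one: "action V0 A 1 = smul (counit A) 1"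
  by (simp add: word_Nil[symmetric] action_word)

lemma word_action_singleton: "word_action V0 A [b] = letter_action V0 A b"
proof -
  have "lin (\<lambda>p. letter_action V0 p b)" by (intro lin_intros)
  from sweedler_counit_right[OF this] show ?thesis by simp
qed

lemma action_letter: "action V0 A (letter b) = letter_action V0 A b"
  by (simp add: letter_eq_word action_word word_action_singleton del: word_action.simps)

lemma action_mult: "action V0 A (B * C) = sweedler (\<lambda>p q. action V0 p B * action V0 q C) A"
proof (rule lin_eq_words[of "\<lambda>B. action V0 A (B * C)"])
  show "action V0 A (word w * C) = sweedler (\<lambda>p q. action V0 p (word w) * action V0 q C) A" for w
  proof (induction w arbitrary: A)
    case Nil
    have "lin (\<lambda>q. action V0 q C)" by (intro lin_intros)
    from sweedler_counit_left[OF this] show ?case by (simp add: word_Nil action_one)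
  next
    case (Cons b w)
    have "action V0 A (word (b # w) * C) =
        sweedler (\<lambda>p q. letter_action V0 p b * action V0 q (word w * C)) A" for A
      by (rule lin_eq_words[of "\<lambda>C. action V0 A (word (b # w) * C)"]; (intro lin_intros)?)
        (simp add: word_append[symmetric] action_word)
    then show ?case
      by (simp add: Cons action_word sweedler_mult_left sweedler_mult_right sweedler_coassoc mult.assoc)
  qed
qed (intro lin_intros)+

lemma action_one_left [simp]: "action V0 1 B = B"
proof (rule lin_eq_words[of "\<lambda>B. action V0 1 B" "\<lambda>B. B"])
  show "action V0 1 (word w) = word w" for w
    unfolding action_word
    by (induction w) (simp_all add: word_Nil sweedler_one letter_action_def, simp add: word_Cons)
qed (intro lin_intros)+

section \<open>Lie elements acting as derivations and coderivations\<close>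

lemma action_Lie_mult:
  "x \<in> Lie \<Longrightarrow> action V0 x (B * C) = action V0 x B * C + B * action V0 x C"
  unfolding action_mult
  by (subst sweedler_primitive) (auto intro!: primitive_Lie lin_intros)

lemma action_Lie_letter:
  "x \<in> Lie \<Longrightarrow> action V0 x (letter b) = (if b \<in> V0 then 0 else bracket (letter b) x)"
  unfolding action_letter letter_action_def
  by (subst sweedler_primitive)
    (auto intro!: primitive_Lie lin_intros simp: antipode_Lie bracket_def)

lemma action_Lie_one: "x \<in> Lie \<Longrightarrow> action V0 x 1 = 0"
  by (simp add: action_one)

lemma action_Lie_bracket:
  "x \<in> Lie \<Longrightarrow> action V0 x (bracket y z) = bracket (action V0 x y) z + bracket y (action V0 x z)"
  by (simp add: bracket_def action_linear action_Lie_mult algebra_simps)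

lemma action_Lie_Lie: "x \<in> Lie \<Longrightarrow> y \<in> Lie \<Longrightarrow> action V0 x y \<in> Lie"
  by (rotate_tac, induction rule: Lie.induct)
    (auto simp: action_Lie_letter action_linear action_Lie_bracket intro: Lie.intros Lie_zero)

lemma bilin_action_args [lin_intros]:
  "bilin F \<Longrightarrow> bilin (\<lambda>p q. F (action V0 x p) q)"
  "bilin F \<Longrightarrow> bilin (\<lambda>p q. F p (action V0 x q))"
  using bilin_left[of F "action V0 x"] bilin_right[of F "action V0 x"]
    lin_action(2)[OF lin_id, of V0 x]
  by (auto simp: bilin_def)

text \<open>The derivation given by \<open>x\<close> sends letters to primitive elements, hence is a
  coderivation for the coproduct.\<close>

lemma sweedler_action:
  assumes x: "x \<in> Lie" and F: "bilin F"
  shows "sweedler F (action V0 x A) =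
    sweedler (\<lambda>p q. F (action V0 x p) q + F p (action V0 x q)) A"
proof (rule lin_eq_words[of "\<lambda>A. sweedler F (action V0 x A)"])
  show "sweedler F (action V0 x (word w)) =
      sweedler (\<lambda>p q. F (action V0 x p) q + F p (action V0 x q)) (word w)" for w
    using F
  proof (induction w arbitrary: F)
    case Nil
    then show ?case
      using x by (simp add: word_Nil action_Lie_one sweedler_one bilin_linear lin_zero[OF lin_sweedler[OF lin_id]])
  next
    case (Cons a w)
    have a: "primitive (action V0 x (letter a))"
      by (intro primitive_Lie action_Lie_Lie x Lie.intros)
    have IH: "sweedler (\<lambda>p q. F (letter a * p) q + F p (letter a * q)) (action V0 x (word w)) =
      sweedler (\<lambda>p q. F (letter a * action V0 x p) q + F (action V0 x p) (letter a * q)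
        + (F (letter a * p) (action V0 x q) + F p (letter a * action V0 x q))) (word w)"
      by (rule Cons.IH) (intro lin_intros Cons.prems)
    show ?case
      unfolding sweedler_word_Cons
      using IH
      by (simp add: word_Cons action_Lie_mult x sweedler_add primitiveD[OF a Cons.prems]
          primitiveD[OF primitive_letter Cons.prems] sweedler_plus bilin_linear[OF Cons.prems] add_ac)
  qed
qed (intro lin_intros)+

text \<open>Letters are sent to Lie elements, which have no constant term; by the product rule no
  word acquires one.\<close>

lemma counit_action: "x \<in> Lie \<Longrightarrow> counit (action V0 x A) = 0"
proof -
  assume x: "x \<in> Lie"
  have "smul (counit (action V0 x A)) (1 :: alg) = 0"
  proof (rule lin_eq_words[of "\<lambda>A. smul (counit (action V0 x A)) 1" "\<lambda>A. 0"])
    show "smul (counit (action V0 x (word w))) (1 :: alg) = 0" for w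
      by (cases w)
        (auto simp: word_Nil action_Lie_one x word_Cons action_Lie_mult action_Lie_Lie Lie.intros)
  qed (intro lin_intros)+
  from arg_cong[OF this, of counit] show ?thesis by simp
qed

text \<open>The image of a letter is a Lie element, on which \<open>antipode\<close> is negation;
  reversal of products is compatible with the product rule.\<close>

lemma antipode_action:
  assumes x: "x \<in> Lie"
  shows "antipode (action V0 x A) = action V0 x (antipode A)"
proof (rule lin_eq_words[of "\<lambda>A. antipode (action V0 x A)"])
  show "antipode (action V0 x (word w)) = action V0 x (antipode (word w))" for w
    by (induction w)
      (simp_all add: word_Nil action_Lie_one x word_Cons action_Lie_mult antipode_linear antipode_mult
        antipode_Lie action_Lie_Lie Lie.intros action_linear)
qed (intro lin_intros)+

lemma action_Lie_letter_action:
  assumes x: "x \<in> Lie"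
  shows "action V0 x (letter_action V0 A b) =
    letter_action V0 (x * A) b + letter_action V0 (action V0 x A) b"
proof (cases "b \<in> V0")
  case True
  then show ?thesis
    by (simp add: letter_action_def action_linear action_Lie_letter counit_action x)
next
  case False
  let ?F = "\<lambda>p q. antipode p * letter b * q"
  have F: "bilin ?F" by (intro lin_intros)
  have "action V0 x (sweedler ?F A) = sweedler (\<lambda>p q. action V0 x (?F p q)) A"
    by (rule lin_of_sweedler) (intro lin_intros)
  \<comment> \<open>On the middle letter \<open>x\<close> produces
    \<open>letter b * x - x * letter b\<close>: the factor \<open>x\<close> joins the right
    component, and \<open>- x\<close> joins the left one as \<open>antipode x\<close>. The outer
    factors give the action of \<open>x\<close> on the components of \<open>A\<close>.\<close>
  also have "\<dots> = sweedler (\<lambda>p q. ?F (x * p) q + ?F p (x * q)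
      + (?F (action V0 x p) q + ?F p (action V0 x q))) A"
    using False by (simp add: action_Lie_mult x action_Lie_letter antipode_mult antipode_Lie antipode_action
        bracket_def algebra_simps)
  finally show ?thesis
    unfolding letter_action_def using False
    by (simp add: primitiveD[OF primitive_Lie[OF x] F] sweedler_action[OF x F] sweedler_plus)
qed

text \<open>Primitivity of \<open>x\<close> and the coderivation property distribute both summands
  on the right over the coproduct of \<open>A\<close>, which reduces a word to its letters.
  \<open>B\<close> is arbitrary because this recursion leaves the Lie algebra.\<close>

lemma action_compose:
  assumes x: "x \<in> Lie"
  shows "action V0 x (action V0 A B) = action V0 (x * A) B + action V0 (action V0 x A) B"
proof (rule lin_eq_words[of "\<lambda>B. action V0 x (action V0 A B)"])
  show "action V0 x (action V0 A (word w)) =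
      action V0 (x * A) (word w) + action V0 (action V0 x A) (word w)" for w
    unfolding action_word
  proof (induction w arbitrary: A)
    case Nil
    then show ?case
      by (simp add: action_linear action_Lie_one counit_action x)
  next
    case (Cons b w)
    let ?F = "\<lambda>p q. letter_action V0 p b * word_action V0 q w"
    have F: "bilin ?F" by (intro lin_intros)
    have "action V0 x (sweedler ?F A) = sweedler (\<lambda>p q. action V0 x (?F p q)) A"
      by (rule lin_of_sweedler) (intro lin_intros)
    also have "\<dots> = sweedler (\<lambda>p q. ?F (x * p) q + ?F p (x * q)
        + (?F (action V0 x p) q + ?F p (action V0 x q))) A"
      by (simp add: action_Lie_mult x Cons action_Lie_letter_action algebra_simps)
    finally show ?case
      by (simp add: primitiveD[OF primitive_Lie[OF x] F] sweedler_action[OF x F] sweedler_plus)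
  qed
qed (intro lin_intros)+

lemma is_Lie_action_action: "is_Lie_action V0 (action V0)"
  unfolding is_Lie_action_def
  by (simp add: action_Lie_Lie action_linear action_Lie_bracket action_Lie_letter)

lemma is_enveloping_action_action: "is_enveloping_action (action V0)"
  unfolding is_enveloping_action_def linear_iff_lin
  by (auto simp: action_Lie_one action_compose action_mult intro!: lin_intros)

text \<open>
  Uniqueness of the action is proved by induction on the number of Lie factors, because this
  filtration is stable under the action of the Lie algebra, whereas the length of words is not.
\<close>
inductive Lie_filtered :: "nat \<Rightarrow> alg \<Rightarrow> bool" where
  one: "Lie_filtered k 1"
| mult: "x \<in> Lie \<Longrightarrow> Lie_filtered k A \<Longrightarrow> Lie_filtered (Suc k) (x * A)"
| plus: "Lie_filtered k A \<Longrightarrow> Lie_filtered k B \<Longrightarrow> Lie_filtered k (A + B)"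
| smul: "Lie_filtered k A \<Longrightarrow> Lie_filtered k (smul c A)"

lemma Lie_filtration_mono: "Lie_filtered k A \<Longrightarrow> Lie_filtered (Suc k) A"
  by (induction rule: Lie_filtered.induct) (auto intro: Lie_filtered.intros)

lemma word_in_Lie_filtration: "Lie_filtered (length w) (word w)"
  by (induction w) (auto simp: word_Nil word_Cons intro: Lie_filtered.intros Lie.intros)

lemma action_Lie_filtration:
  assumes "x \<in> Lie"
  shows "Lie_filtered k A \<Longrightarrow> Lie_filtered k (action V0 x A)"
proof (induction rule: Lie_filtered.induct)
  case (one k)
  then show ?case
    using Lie_filtered.smul[OF Lie_filtered.one, of k 0] by (simp add: action_Lie_one assms)
next
  case (mult y k A)
  then show ?case
    using assms by (simp add: action_Lie_mult Lie_filtered.intros action_Lie_Lie)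
qed (simp_all add: action_linear Lie_filtered.intros)

text \<open>The coproduct distributes the Lie factors of a product over the two components, so
  neither component needs more factors than the product. Bilinear maps express this dually.\<close>

lemma sweedler_Lie_filtration_zero:
  assumes "Lie_filtered k A" "bilin H"
    and "\<And>p q. Lie_filtered k p \<Longrightarrow> Lie_filtered k q \<Longrightarrow> H p q = 0"
  shows "sweedler H A = 0"
  using assms
proof (induction arbitrary: H rule: Lie_filtered.induct)
  case (mult x k A)
  have "sweedler (\<lambda>p q. H (x * p) q + H p (x * q)) A = 0"
    by (rule mult.IH)
      (auto intro!: lin_intros mult.prems simp: Lie_filtered.mult Lie_filtration_mono mult.hyps mult.prems(2))
  then show ?case
    by (simp add: primitiveD[OF primitive_Lie] mult)
qed (auto simp: sweedler_one sweedler_add sweedler_smul intro: Lie_filtered.one)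

lemma sweedler_Lie_filtration_cong:
  assumes "Lie_filtered k A" "bilin F" "bilin G"
    and "\<And>p q. Lie_filtered k p \<Longrightarrow> Lie_filtered k q \<Longrightarrow> F p q = G p q"
  shows "sweedler F A = sweedler G A"
proof -
  have "sweedler (\<lambda>p q. F p q - G p q) A = 0"
    by (rule sweedler_Lie_filtration_zero[OF assms(1)])
      (use assms in \<open>auto simp: bilin_def intro!: lin_intros\<close>)
  then show ?thesis by (simp add: sweedler_minus)
qed

lemma sweedler_word_cong:
  assumes "\<And>u v. length u + length v = length w \<Longrightarrow> F (word u) (word v) = G (word u) (word v)"
  shows "sweedler F (word w) = sweedler G (word w)"
  unfolding sweedler_word
  by (rule arg_cong[of _ _ sum_list]) (auto intro!: map_cong assms splits_length)

lemma sweedler_word_extreme: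
  assumes "\<And>u v. u \<noteq> [] \<Longrightarrow> length u + length v = length w \<Longrightarrow> F (word u) (word v) = 0"
  shows "sweedler F (word w) = F 1 (word w)"
  using assms
proof (induction w arbitrary: F)
  case (Cons a w)
  have "sweedler F (word (a # w)) = sweedler (\<lambda>p q. F p (letter a * q)) (word w)"
    unfolding sweedler_word_Cons
    by (rule sweedler_word_cong) (simp add: Cons.prems word_Cons[symmetric])
  also have "\<dots> = F 1 (word (a # w))"
    by (subst Cons.IH) (simp_all add: Cons.prems word_Cons[symmetric])
  finally show ?case .
qed (simp add: word_Nil sweedler_one)

lemma enveloping_action_one:
  assumes "is_enveloping_action T"
  shows "T A 1 = smul (counit A) 1"
proof (rule lin_eq_words[of "\<lambda>A. T A 1"])
  show "T (word w) 1 = smul (counit (word w)) 1" for w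
  proof (induction "length w" arbitrary: w rule: less_induct)
    case less
    have T: "T (word v) 1 = 0" if "v \<noteq> []" "length v < length w" for v
      using less[OF that(2)] that by simp
    show ?case
    proof (cases w)
      case Nil
      then show ?thesis using assms by (simp add: word_Nil is_enveloping_action_def)
    next
      case (Cons a w')
      \<comment> \<open>Of all splits only the two with an empty component survive the induction
        hypothesis. As \<open>T 1 1 = 1\<close>, the value at \<open>1 * 1\<close> equals twice
        itself and is zero.\<close>
      have "T (word w) (1 * 1) = sweedler (\<lambda>p q. T p 1 * T q 1) (word w)"
        using assms unfolding is_enveloping_action_def by blast
      also have "\<dots> = sweedler (\<lambda>q p. T (letter a * p) 1 * T q 1) (word w')
          + sweedler (\<lambda>p q. T p 1 * T (letter a * q) 1) (word w')"
        unfolding Cons sweedler_word_Cons sweedler_plus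
        by (rule arg_cong2[of _ _ _ _ plus, OF sweedler_cocommute refl])
      also have "\<dots> = T (word w) 1 * T 1 1 + T 1 1 * T (word w) 1"
        by (rule arg_cong2[of _ _ _ _ plus]; subst sweedler_word_extreme)
          (auto simp: T Cons word_Cons)
      finally have "T (word w) 1 = 0"
        using assms by (simp add: is_enveloping_action_def)
      then show ?thesis using Cons by simp
    qed
  qed
qed (use assms in \<open>auto simp: is_enveloping_action_def linear_iff_lin intro: lin_intros\<close>)

lemma enveloping_action_unique:
  assumes L: "is_Lie_action V0 T" and E: "is_enveloping_action T"
  shows "T = action V0"
proof -
  have linT: "lin (\<lambda>B. T A B)" "lin (\<lambda>A. T A B)" for A B
    using E unfolding is_enveloping_action_def linear_iff_lin by blast+
  have T1 [simp]: "T 1 A = A" for A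
    using E unfolding is_enveloping_action_def by blast
  have Tmult: "T A (B * C) = sweedler (\<lambda>p q. T p B * T q C) A" for A B C
    using E unfolding is_enveloping_action_def by blast
  have Tcompose: "T (x * A) y = T x (T A y) - T (T x A) y" if "x \<in> Lie" "y \<in> Lie" for x A y
    using E that unfolding is_enveloping_action_def by blast
  have bilT: "bilin (\<lambda>p q. T p B * T q C)" for B C
    by (intro lin_intros linT)
  \<comment> \<open>The coproduct axiom and primitivity of \<open>x\<close> make \<open>T x\<close>
    a derivation of the whole algebra, so agreement on letters suffices.\<close>
  have Tx: "T x B = action V0 x B" if x: "x \<in> Lie" for x B
  proof (rule lin_eq_words[of "T x"])
    show "T x (word w) = action V0 x (word w)" for w
    proof (induction w)
      case Nil
      show ?case
        using E x by (simp add: word_Nil action_Lie_one is_enveloping_action_def)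
    next
      case (Cons b w)
      have "T x (letter b) = action V0 x (letter b)"
        using L x unfolding is_Lie_action_def action_Lie_letter[OF x] by blast
      then show ?case
        using Cons by (simp add: word_Cons Tmult action_Lie_mult x
            sweedler_primitive[OF primitive_Lie[OF x] bilT])
    qed
  qed (intro linT lin_intros)+
  have filtered: "Lie_filtered k A \<Longrightarrow> T A B = action V0 A B" for k A B
  proof (induction k arbitrary: A B rule: less_induct)
    case (less k)
    \<comment> \<open>For a product \<open>x * A\<close>, \<open>Tcompose\<close> expresses the
      value on a letter through \<open>A\<close> and \<open>T x A\<close>; both lie in a lower
      filtration degree, since the Lie action preserves the filtration.\<close>
    have letters: "T A (letter b) = action V0 A (letter b)" if "Lie_filtered k A" for A b
      using that less.IH
    proof (induction rule: Lie_filtered.induct)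
      case (mult x k A)
      have "T A (letter b) = action V0 A (letter b)" "T (action V0 x A) (letter b) = action V0 (action V0 x A) (letter b)"
        using mult.prems[of k] mult.hyps by (auto intro: action_Lie_filtration)
      then show ?case
        using action_compose[OF mult.hyps(1), of V0 A "letter b"]
        by (simp add: Tcompose mult.hyps Lie.intros Tx)
    qed (auto simp: action_linear lin_add[OF linT(2)] lin_smul[OF linT(2)])
    show ?case
    proof (rule lin_eq_words[of "T A"])
      show "T A (word w) = action V0 A (word w)" for w
        using less.prems
      proof (induction w arbitrary: A)
        case Nil
        then show ?case
          by (simp add: word_Nil enveloping_action_one[OF E] action_one)
      next
        case (Cons b w)
        show ?case
          unfolding word_Cons Tmult action_mult
          \<comment> \<open>Both Sweedler components stay in degree \<open>k\<close>, so the letter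
            case and the induction over the word apply to them.\<close>
          by (rule sweedler_Lie_filtration_cong[OF Cons.prems])
            (auto intro!: lin_intros linT simp: letters Cons.IH)
      qed
    qed (intro linT lin_intros)+
  qed
  have "T A B = action V0 A B" for A B
    by (rule lin_eq_words[of "\<lambda>A. T A B" "\<lambda>A. action V0 A B"])
      (intro linT lin_intros filtered[OF word_in_Lie_filtration])+
  then show ?thesis by blast
qed

lemma act_eq_action: "act V0 = action V0"
  unfolding act_def
  by (rule the_equality)
    (auto simp: is_Lie_action_action is_enveloping_action_action enveloping_action_unique)

section \<open>Linear functionals and coefficients\<close>

definition functional :: "(('k \<Rightarrow>\<^sub>0 rat) \<Rightarrow> rat) \<Rightarrow> bool" where
  "functional \<phi> \<longleftrightarrow> (\<forall>x y. \<phi> (x + y) = \<phi> x + \<phi> y) \<and> (\<forall>c x. \<phi> (smul c x) = c * \<phi> x)"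

lemma functional_eq_words:
  assumes "functional \<phi>" "functional \<psi>" "\<And>w. \<phi> (word w) = \<psi> (word w)"
  shows "\<phi> x = \<psi> x"
proof -
  \<comment> \<open>Scalars are encoded as functions on the one-point type, which makes
    \<open>lin_eq_words\<close> applicable to functionals.\<close>
  have "Poly_Mapping.single () (\<phi> x) = Poly_Mapping.single () (\<psi> x)"
    by (rule lin_eq_words[of "\<lambda>x. Poly_Mapping.single () (\<phi> x)"])
      (use assms in \<open>auto simp: lin_def functional_def single_add\<close>)
  then show ?thesis by (metis lookup_single_eq)
qed

named_theorems functional_intros

lemma functional_lookup [functional_intros]:
  "lin F \<Longrightarrow> functional (\<lambda>x. Poly_Mapping.lookup (F x) k)"
  by (simp add: functional_def lin_def lookup_add)

lemma functional_scale [functional_intros]: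
  "functional \<phi> \<Longrightarrow> functional (\<lambda>x. c * \<phi> x)" "functional \<phi> \<Longrightarrow> functional (\<lambda>x. \<phi> x * c)"
  by (simp_all add: functional_def algebra_simps)

lemma functional_sum [functional_intros]:
  "(\<And>i. functional (\<lambda>x. \<phi> x i)) \<Longrightarrow> functional (\<lambda>x. \<Sum>i\<in>S. \<phi> x i)"
  by (simp add: functional_def sum.distrib sum_distrib_left)

lemma functional_sum_list [functional_intros]:
  "(\<And>i. functional (\<lambda>x. \<phi> x i)) \<Longrightarrow> functional (\<lambda>x. \<Sum>i\<leftarrow>l. \<phi> x i)"
  by (induction l) (simp_all add: functional_def algebra_simps)

lemma functional_pairing [functional_intros]:
  "lin F \<Longrightarrow> functional (\<lambda>x. pairing d (F x))"
  unfolding pairing_def by (intro functional_intros)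

lemma pairing_single: "pairing d (Poly_Mapping.single k 1) = Poly_Mapping.lookup d k"
  by (simp add: pairing_def lookup_single when_def in_keys_iff if_distrib sum.delta cong: if_cong)

lemma pairing_word: "pairing d (word w) = Poly_Mapping.lookup d w"
  by (simp add: word_def pairing_single)

section \<open>Coefficients of concatenation products\<close>

lemma lookup_word: "Poly_Mapping.lookup (word u) w = (if u = w then 1 else 0)"
  by (simp add: word_def lookup_single when_def)

lemma lookup_letter_mult:
  "Poly_Mapping.lookup (letter v * f) [] = 0"
  "Poly_Mapping.lookup (letter v * f) (b # w) = (if b = v then Poly_Mapping.lookup f w else 0)"
proof -
  show "Poly_Mapping.lookup (letter v * f) [] = 0"
    using counit_mult[of "letter v" f] by (simp add: counit_def[symmetric])
  have "Poly_Mapping.lookup (letter v * f) (b # w) = (if b = v then 1 else 0) * Poly_Mapping.lookup f w"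
    by (rule functional_eq_words[of "\<lambda>f. Poly_Mapping.lookup (letter v * f) (b # w)"];
        (intro functional_intros lin_intros)?)
      (auto simp: word_Cons[symmetric] lookup_word)
  then show "Poly_Mapping.lookup (letter v * f) (b # w) = (if b = v then Poly_Mapping.lookup f w else 0)"
    by simp
qed

lemma lookup_mult_take_drop:
  fixes f g :: alg
  shows "Poly_Mapping.lookup (f * g) w =
    (\<Sum>i\<in>{..length w}. Poly_Mapping.lookup f (take i w) * Poly_Mapping.lookup g (drop i w))"
proof (rule functional_eq_words[of "\<lambda>f. Poly_Mapping.lookup (f * g) w"])
  show "Poly_Mapping.lookup (word u * g) w =
    (\<Sum>i\<in>{..length w}. Poly_Mapping.lookup (word u) (take i w) * Poly_Mapping.lookup g (drop i w))" for u
  proof (rule functional_eq_words[of "\<lambda>g. Poly_Mapping.lookup (word u * g) w"])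
    fix v
    have "Poly_Mapping.lookup (word u) (take i w) * Poly_Mapping.lookup (word v) (drop i w) =
        (if i = length u then (if u @ v = w then 1 else 0) else 0)" if "i \<le> length w" for i
    proof -
      have "u = take i w \<and> v = drop i w \<longleftrightarrow> i = length u \<and> u @ v = w"
        using that by auto
      moreover have "Poly_Mapping.lookup (word u) (take i w) * Poly_Mapping.lookup (word v) (drop i w) =
          (if u = take i w \<and> v = drop i w then 1 else 0)"
        unfolding lookup_word by simp
      ultimately show ?thesis by metis
    qed
    then have "(\<Sum>i\<in>{..length w}. Poly_Mapping.lookup (word u) (take i w) *
          Poly_Mapping.lookup (word v) (drop i w)) =
        (\<Sum>i\<in>{..length w}. if i = length u then (if u @ v = w then 1 else 0) else 0)"
      by (intro sum.cong refl) blast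
    also have "\<dots> = (if u @ v = w then 1 else 0)"
      by (auto simp: sum.delta)
    finally show "Poly_Mapping.lookup (word u * word v) w = (\<Sum>i\<in>{..length w}.
        Poly_Mapping.lookup (word u) (take i w) * Poly_Mapping.lookup (word v) (drop i w))"
      by (simp add: word_append[symmetric] lookup_word)
  qed (intro functional_intros lin_intros)+
qed (intro functional_intros lin_intros)+

text \<open>Words are written through positions of \<open>a\<close>, so that the occurrence of
  \<open>v\<close> singled out by the product becomes an index \<open>j\<close>; this is the source
  of the indices \<open>j\<^sub>1 < \<dots> < j\<^sub>k\<close> in the formula.\<close>

lemma lookup_mult_letter_mult:
  "Poly_Mapping.lookup (f * (letter v * g)) (map a [Suc l..<Suc n]) =
    (\<Sum>j\<in>{j\<in>{l<..n}. a j = v}. Poly_Mapping.lookup f (map a [Suc l..<j]) *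
       Poly_Mapping.lookup g (map a [Suc j..<Suc n]))" (is "?L = _")
proof -
  let ?h = "\<lambda>j. Poly_Mapping.lookup f (map a [Suc l..<j]) *
       Poly_Mapping.lookup (letter v * g) (map a [j..<Suc n])"
  have "take i [Suc l..<Suc n] = [Suc l..<i + Suc l]" if "i \<le> n - l" for i
    using that by (cases "l \<le> n") (auto simp: take_upt add.commute simp del: upt_Suc)
  then have "?L = (\<Sum>i\<in>{..n - l}. ?h (i + Suc l))"
    unfolding lookup_mult_take_drop[of f]
    by (intro sum.cong) (auto simp: take_map drop_map add.commute simp del: upt_Suc)
  \<comment> \<open>The last cut leaves the empty word for \<open>letter v * g\<close>, whose
    coefficient there is zero.\<close>
  also have "\<dots> = (\<Sum>i\<in>{..<n - l}. ?h (i + Suc l))"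
    by (rule sum.mono_neutral_right) (auto simp: lookup_letter_mult not_less simp del: upt_Suc)
  also have "\<dots> = (\<Sum>j\<in>{l<..n}. ?h j)"
    by (rule sum.reindex_bij_witness[of _ "\<lambda>j. j - Suc l" "\<lambda>i. i + Suc l"]) auto
  also have "\<dots> = (\<Sum>j\<in>{l<..n}. if a j = v then Poly_Mapping.lookup f (map a [Suc l..<j]) *
       Poly_Mapping.lookup g (map a [Suc j..<Suc n]) else 0)"
    by (rule sum.cong) (auto simp: upt_conv_Cons lookup_letter_mult simp del: upt_Suc)
  also have "\<dots> = (\<Sum>j\<in>{j\<in>{l<..n}. a j = v}. Poly_Mapping.lookup f (map a [Suc l..<j]) *
       Poly_Mapping.lookup g (map a [Suc j..<Suc n]))"
    by (rule sum.inter_filter[symmetric]) simp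
  finally show ?thesis .
qed

section \<open>Duality of the shuffle product and the coproduct\<close>

lemma sum_splits_Nil:
  fixes h :: "_ \<Rightarrow> 'b :: comm_monoid_add"
  shows "(\<Sum>(x, y)\<leftarrow>splits u. if x = [] then h y else 0) = h u"
    "(\<Sum>(x, y)\<leftarrow>splits u. if y = [] then h x else 0) = h u"
  by (induction u arbitrary: h) (simp_all add: case_prod_beta' o_def cong: if_cong)

text \<open>The first letter of a shuffle comes from \<open>s\<close> or from \<open>t\<close>, just
  as the first letter of \<open>u\<close> goes to one of the two components of a split; the two
  recursions agree.\<close>

lemma lookup_shuffle_word:
  "Poly_Mapping.lookup (shuffle_word s t) u =
    (\<Sum>(x, y)\<leftarrow>splits u. if s = x \<and> t = y then 1 else 0)"
proof (induction s t arbitrary: u rule: shuffle_word.induct)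
  case (1 v)
  have "(\<Sum>(x, y)\<leftarrow>splits u. if [] = x \<and> v = y then 1 else 0 :: rat) =
      (\<Sum>(x, y)\<leftarrow>splits u. if x = [] then if v = y then 1 else 0 else 0)"
    by (rule arg_cong[of _ _ sum_list]) auto
  then show ?case
    by (simp only: sum_splits_Nil shuffle_word.simps lookup_word)
next
  case (2 a s)
  have "(\<Sum>(x, y)\<leftarrow>splits u. if a # s = x \<and> [] = y then 1 else 0 :: rat) =
      (\<Sum>(x, y)\<leftarrow>splits u. if y = [] then if a # s = x then 1 else 0 else 0)"
    by (rule arg_cong[of _ _ sum_list]) auto
  then show ?case
    by (simp only: sum_splits_Nil shuffle_word.simps lookup_word)
next
  case (3 a s b t)
  then show ?case
    by (cases u) (auto simp: lookup_add lookup_letter_mult case_prod_beta' o_def)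
qed

lemma lin_shuffle [lin_intros]:
  "lin F \<Longrightarrow> lin (\<lambda>x. shuffle (F x) g)" "lin F \<Longrightarrow> lin (\<lambda>x. shuffle f (F x))"
  unfolding shuffle_def by (intro lin_intros; assumption)+

lemma lookup_shuffle:
  "Poly_Mapping.lookup (shuffle f g) u =
    (\<Sum>p\<leftarrow>splits u. Poly_Mapping.lookup f (fst p) * Poly_Mapping.lookup g (snd p))"
proof (rule functional_eq_words[of "\<lambda>f. Poly_Mapping.lookup (shuffle f g) u"])
  show "Poly_Mapping.lookup (shuffle (word s) g) u =
    (\<Sum>p\<leftarrow>splits u. Poly_Mapping.lookup (word s) (fst p) * Poly_Mapping.lookup g (snd p))" for s
  proof (rule functional_eq_words[of "\<lambda>g. Poly_Mapping.lookup (shuffle (word s) g) u"])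
    show "Poly_Mapping.lookup (shuffle (word s) (word t)) u = (\<Sum>p\<leftarrow>splits u.
        Poly_Mapping.lookup (word s) (fst p) * Poly_Mapping.lookup (word t) (snd p))" for t
      unfolding shuffle_def lin_ext_word lookup_shuffle_word
      by (rule arg_cong[of _ _ sum_list]) (auto simp: lookup_word)
  qed (intro functional_intros lin_intros)+
qed (intro functional_intros lin_intros)+

lemma shuffle_one_right: "shuffle f 1 = f"
proof (rule lin_eq_words[of "\<lambda>f. shuffle f 1" "\<lambda>f. f"])
  show "shuffle (word w) 1 = word w" for w
    by (cases w) (simp_all add: shuffle_def word_Nil[symmetric])
qed (intro lin_intros)+

section \<open>The maps I and their symmetry\<close>

lemma I_cases:
  "\<not> in_V0 V0 p \<Longrightarrow> in_V0 V0 q \<Longrightarrow> I V0 p f q = f"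
  "in_V0 V0 p \<Longrightarrow> \<not> in_V0 V0 q \<Longrightarrow> I V0 p f q = antipode f"
  "in_V0 V0 p = in_V0 V0 q \<Longrightarrow> I V0 p f q = smul (counit f) 1"
  by (auto simp: I_def word_Nil[symmetric] pairing_word counit_def)

lemma lin_I [lin_intros]: "lin F \<Longrightarrow> lin (\<lambda>x. I V0 p (F x) q)"
  by (cases "in_V0 V0 p"; cases "in_V0 V0 q") (simp_all add: I_cases lin_intros)

text \<open>Self-adjointness in the basis of words: the identity and the projection to the constant
  term are symmetric, and so is signed reversal, because \<open>rev\<close> is a length-preserving
  involution.\<close>

lemma lookup_I_word:
  "Poly_Mapping.lookup (I V0 p (word u) q) w = Poly_Mapping.lookup (I V0 p (word w) q) u"
  by (auto simp: I_def antipode_word word_Nil[symmetric] pairing_word lookup_word)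

section \<open>The product \<open>\<circledast>\<close> on words\<close>

text \<open>\<open>A\<close> is what remains to be distributed and \<open>p\<close> is the left end
  of the next gap. Each gap receives a single component of \<open>A\<close>, transformed by
  \<open>I\<close>.\<close>

primrec gap_product :: "letter set \<Rightarrow> endpoint \<Rightarrow> alg \<Rightarrow> letter list \<Rightarrow> alg" where
  "gap_product V0 p A [] = I V0 p A Formal_inside"
| "gap_product V0 p A (v # vs) =
     sweedler (\<lambda>g h. I V0 p g (Letter v) * (letter v * gap_product V0 (Letter v) h vs)) A"

text \<open>
  A letter outside \<open>V\<^sub>0\<close> receives an antipode on its left and a copy of the acting element on its
  right; between two such letters the two copies cancel by the antipode axiom.
\<close>
lemma gap_product_eq:
  "gap_product V0 p A w =
    (if in_V0 V0 p then word_action V0 A w else sweedler (\<lambda>g h. g * word_action V0 h w) A)"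
proof (induction w arbitrary: p A)
  case Nil
  show ?case
    using sweedler_counit_right[OF lin_id, of A] by (simp add: I_cases)
next
  case (Cons v w)
  let ?X = "\<lambda>A. sweedler (\<lambda>g h. g * word_action V0 h w) A"
  have outside: "word_action V0 A (v # w) =
      sweedler (\<lambda>g h. antipode g * (letter v * ?X h)) A" if "v \<notin> V0" for A
    using that
    by (simp add: letter_action_def sweedler_mult_left sweedler_mult_right sweedler_coassoc mult.assoc)
  have inside: "word_action V0 A (v # w) = letter v * word_action V0 A w" if "v \<in> V0" for A
    using that sweedler_counit_left[of "\<lambda>h. letter v * word_action V0 h w" A]
    by (simp add: letter_action_def lin_intros)
  have cancel: "sweedler (\<lambda>g h. g * word_action V0 h (v # w)) A = letter v * ?X A" if "v \<notin> V0"
  proof -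
    have "sweedler (\<lambda>g h. g * word_action V0 h (v # w)) A =
        sweedler (\<lambda>g h. sweedler (\<lambda>k r. g * antipode k * (letter v * ?X r)) h) A"
      unfolding outside[OF that] sweedler_mult_left by (simp add: mult.assoc)
    also have "\<dots> = sweedler (\<lambda>g r. sweedler (\<lambda>h k. h * antipode k) g * (letter v * ?X r)) A"
      unfolding sweedler_coassoc sweedler_mult_right ..
    also have "\<dots> = letter v * ?X A"
      using sweedler_counit_left[of "\<lambda>r. letter v * ?X r" A]
      by (simp add: sweedler_antipode lin_intros)
    finally show ?thesis .
  qed
  \<comment> \<open>When both ends of a gap lie in \<open>V0\<close>, or both outside,
    \<open>I\<close> is the counit and the whole of \<open>A\<close> passes on to the later
    gaps.\<close>
  have scalar: "sweedler (\<lambda>g h. smul (counit g) (letter v * gap_product V0 (Letter v) h w)) A =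
      letter v * gap_product V0 (Letter v) A w"
    by (rule sweedler_counit_left) (cases "v \<in> V0"; simp add: Cons lin_intros)
  show ?case
  proof (cases "in_V0 V0 p"; cases "v \<in> V0")
    assume "in_V0 V0 p" "v \<in> V0"
    then show ?thesis
      using scalar by (simp add: I_cases inside Cons del: word_action.simps)
  next
    assume "in_V0 V0 p" "v \<notin> V0"
    then show ?thesis
      by (simp add: I_cases outside Cons del: word_action.simps)
  next
    assume "\<not> in_V0 V0 p" "v \<in> V0"
    then show ?thesis
      by (simp add: I_cases inside Cons del: word_action.simps)
  next
    assume "\<not> in_V0 V0 p" "v \<notin> V0"
    then show ?thesis
      using scalar by (simp add: I_cases cancel Cons del: word_action.simps)
  qed
qed

lemma circled_ast_word: "circled_ast V0 A (word w) = gap_product V0 Formal_outside A w"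
  by (simp add: circled_ast_def act_eq_action action_word gap_product_eq)

lemma lin_circled_ast [lin_intros]:
  "lin F \<Longrightarrow> lin (\<lambda>x. circled_ast V0 (F x) B)" "lin F \<Longrightarrow> lin (\<lambda>x. circled_ast V0 A (F x))"
  unfolding circled_ast_def act_eq_action by (intro lin_intros; assumption)+

section \<open>Comparison of coefficients\<close>

text \<open>Positions rather than subwords are recorded, since repeated letters make a subword occur
  several times; the lower bound \<open>l\<close> serves the recursion on the first
  position.\<close>

definition sublists_from :: "(nat \<Rightarrow> letter) \<Rightarrow> nat \<Rightarrow> nat \<Rightarrow> letter list \<Rightarrow> nat list set" where
  "sublists_from a n l vs = {js. sorted_wrt (<) js \<and> set js \<subseteq> {l<..n} \<and> map a js = vs}"

lemma finite_sublists_from: "finite (sublists_from a n l vs)"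
proof (rule finite_subset)
  show "sublists_from a n l vs \<subseteq> {js. set js \<subseteq> {l<..n} \<and> length js = length vs}"
    by (auto simp: sublists_from_def)
qed (rule finite_lists_length_eq, simp)

lemma sublists_from_Nil: "sublists_from a n l [] = {[]}"
  by (auto simp: sublists_from_def)

lemma sublists_from_Cons:
  "sublists_from a n l (v # vs) =
    (\<Union>j\<in>{j\<in>{l<..n}. a j = v}. (#) j ` sublists_from a n j vs)"
proof (intro set_eqI iffI)
  fix js assume "js \<in> sublists_from a n l (v # vs)"
  then obtain j js' where "js = j # js'" "j \<in> {j\<in>{l<..n}. a j = v}" "js' \<in> sublists_from a n j vs"
    by (cases js) (auto simp: sublists_from_def subset_iff)
  then show "js \<in> (\<Union>j\<in>{j\<in>{l<..n}. a j = v}. (#) j ` sublists_from a n j vs)"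
    by blast
qed (fastforce simp: sublists_from_def)

lemma sum_sublists_from_Cons:
  "(\<Sum>js\<in>sublists_from a n l (v # vs). f js) =
    (\<Sum>j\<in>{j\<in>{l<..n}. a j = v}. \<Sum>js\<in>sublists_from a n j vs. f (j # js))"
  unfolding sublists_from_Cons
  by (subst sum.UNION_disjoint) (auto simp: finite_sublists_from sum.reindex)

text \<open>The shuffle product of the formula in a recursive form parallel to
  \<open>gap_product\<close>; \<open>l\<close> is the position just before the current gap and
  \<open>p\<close> its left end.\<close>

primrec gap_shuffle ::
  "letter set \<Rightarrow> (nat \<Rightarrow> letter) \<Rightarrow> nat \<Rightarrow> endpoint \<Rightarrow> nat \<Rightarrow> nat list \<Rightarrow> alg" where
  "gap_shuffle V0 a n p l [] = I V0 p (segment a (l + 1) (n + 1)) Formal_inside"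
| "gap_shuffle V0 a n p l (j # js) =
     shuffle (I V0 p (segment a (l + 1) j) (Letter (a j)))
       (gap_shuffle V0 a n (Letter (a j)) j js)"

lemma sum_list_sum: "(\<Sum>x\<leftarrow>xs. \<Sum>i\<in>S. f x i) = (\<Sum>i\<in>S. \<Sum>x\<leftarrow>xs. f x i)"
  by (induction xs) (auto simp: sum.distrib)

lemma lookup_sum_list:
  "Poly_Mapping.lookup (\<Sum>x\<leftarrow>xs. f x) k = (\<Sum>x\<leftarrow>xs. Poly_Mapping.lookup (f x) k)"
  by (induction xs) (auto simp: lookup_add)

text \<open>Transposition gap by gap: self-adjointness moves \<open>I\<close> from a piece of
  \<open>u\<close> to a segment of \<open>a\<close>, the position of \<open>v\<close> in the
  concatenation becomes the index \<open>j\<close>, and the sum over the splits of \<open>u\<close>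
  becomes a coefficient of a shuffle product.\<close>

lemma lookup_gap_product:
  "Poly_Mapping.lookup (gap_product V0 p (word u) vs) (map a [Suc l..<Suc n]) =
    (\<Sum>js\<in>sublists_from a n l vs. Poly_Mapping.lookup (gap_shuffle V0 a n p l js) u)"
proof (induction vs arbitrary: p u l)
  case Nil
  show ?case
    by (subst gap_product.simps, subst lookup_I_word) (simp add: sublists_from_Nil segment_def)
next
  case (Cons v vs)
  let ?I = "\<lambda>j. I V0 p (segment a (Suc l) j) (Letter v)"
  have "Poly_Mapping.lookup (gap_product V0 p (word u) (v # vs)) (map a [Suc l..<Suc n]) =
    (\<Sum>q\<leftarrow>splits u. \<Sum>j\<in>{j\<in>{l<..n}. a j = v}. Poly_Mapping.lookup (?I j) (fst q) *
      (\<Sum>js\<in>sublists_from a n j vs.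
         Poly_Mapping.lookup (gap_shuffle V0 a n (Letter v) j js) (snd q)))"
    unfolding gap_product.simps sweedler_word lookup_sum_list case_prod_beta
      lookup_mult_letter_mult Cons.IH
    by (subst lookup_I_word) (simp add: segment_def)
  also have "\<dots> = (\<Sum>j\<in>{j\<in>{l<..n}. a j = v}. \<Sum>js\<in>sublists_from a n j vs.
      Poly_Mapping.lookup (shuffle (?I j) (gap_shuffle V0 a n (Letter v) j js)) u)"
    unfolding lookup_shuffle sum_distrib_left sum_list_sum ..
  also have "\<dots> = (\<Sum>js\<in>sublists_from a n l (v # vs).
      Poly_Mapping.lookup (gap_shuffle V0 a n p l js) u)"
    unfolding sum_sublists_from_Cons by (intro sum.cong) auto
  finally show ?case .
qed

text \<open>The left end \<open>l\<close> replaces the index 0 so that the tail of \<open>js\<close>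
  is again an instance, with left end \<open>j\<close>.\<close>

lemma shuffle_list_eq_gap_shuffle:
  assumes "set js \<subseteq> {1..n}"
  shows "shuffle_list
     (map (\<lambda>p. I V0 (with_endpoints n a ((l # js @ [n + 1]) ! p))
        (segment a ((l # js @ [n + 1]) ! p + 1) ((l # js @ [n + 1]) ! (p + 1)))
        (with_endpoints n a ((l # js @ [n + 1]) ! (p + 1)))) [0..<length js + 1]) =
    gap_shuffle V0 a n (with_endpoints n a l) l js"
  using assms
proof (induction js arbitrary: l)
  case Nil
  show ?case
    by (simp add: shuffle_list_def shuffle_one_right with_endpoints_def)
next
  case (Cons j js)
  have j: "with_endpoints n a j = Letter (a j)"
    using Cons.prems by (auto simp: with_endpoints_def)
  \<comment> \<open>The gap with \<open>p = 0\<close> is split off and the remaining gaps are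
    shifted by one.\<close>
  have "[0..<length (j # js) + 1] = 0 # map Suc [0..<length js + 1]"
    by (simp add: map_Suc_upt upt_conv_Cons del: upt_Suc)
  then show ?case
    using Cons j by (simp add: shuffle_list_def o_def del: upt_Suc)
qed

section \<open>Reading off coefficients in the tensor square\<close>

lemma lin_tensor [lin_intros]:
  "lin F \<Longrightarrow> lin (\<lambda>x. F x \<otimes> g)" "lin F \<Longrightarrow> lin (\<lambda>x. f \<otimes> F x)"
  unfolding tensor_def by (intro lin_intros; assumption)+

lemma lookup_tensor_word:
  "Poly_Mapping.lookup (f \<otimes> word w) (u, v) = (if v = w then Poly_Mapping.lookup f u else 0)"
proof -
  have "Poly_Mapping.lookup (f \<otimes> word w) (u, v) = Poly_Mapping.lookup f u * (if v = w then 1 else 0)"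
    by (rule functional_eq_words[of "\<lambda>f. Poly_Mapping.lookup (f \<otimes> word w) (u, v)"];
        (intro functional_intros lin_intros)?)
      (auto simp: lookup_word lookup_single when_def)
  then show ?thesis by simp
qed

text \<open>Fixing the second tensor component imposes \<open>map a js = v\<close>. The grading by
  \<open>k\<close> then merges into one sum, since a strictly increasing list in
  \<open>{1..n}\<close> is distinct and so has length at most \<open>n\<close>.\<close>

lemma index_seqs_sum:
  "(\<Sum>k\<in>{0..n}. \<Sum>js\<in>index_seqs n k. if v = map a js then f js else 0) =
    (\<Sum>js\<in>sublists_from a n 0 v. f js)"
proof -
  have fin: "finite (index_seqs n k)" for k
    by (rule finite_subset[of _ "{js. set js \<subseteq> {1..n} \<and> length js = k}"])
      (auto simp: index_seqs_def intro: finite_lists_length_eq)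
  have len: "length js \<le> n" if "sorted_wrt (<) js" "set js \<subseteq> {0<..n}" for js :: "nat list"
    using that card_mono[of "{0<..n}" "set js"] strict_sorted_iff[of js] distinct_card[of js] by simp
  have "(\<Sum>k\<in>{0..n}. \<Sum>js\<in>index_seqs n k. if v = map a js then f js else 0) =
      (\<Sum>js\<in>(\<Union>k\<in>{0..n}. index_seqs n k). if v = map a js then f js else 0)"
    by (subst sum.UNION_disjoint) (use fin in \<open>auto simp: index_seqs_def\<close>)
  also have "\<dots> = (\<Sum>js\<in>{js \<in> (\<Union>k\<in>{0..n}. index_seqs n k). v = map a js}. f js)"
    by (rule sum.inter_filter[symmetric]) (use fin in auto)
  also have "{js \<in> (\<Union>k\<in>{0..n}. index_seqs n k). v = map a js} = sublists_from a n 0 v"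
    using len by (auto simp: sublists_from_def index_seqs_def subset_iff Suc_le_eq)
  finally show ?thesis .
qed

text \<open>Pairing with \<open>word u \<otimes> word v\<close> reads off a coefficient, which gives
  uniqueness; bilinearity extends the identity from words to all \<open>A\<close> and
  \<open>B\<close>, which gives existence.\<close>

lemma Delta_I_eqI:
  assumes "\<And>u v. Poly_Mapping.lookup d (u, v) = pairing f (circled_ast V0 (word u) (word v))"
  shows "Delta_I V0 f = d"
  unfolding Delta_I_def
proof (rule the_equality)
  show "\<forall>A B. pairing d (A \<otimes> B) = pairing f (circled_ast V0 A B)"
  proof (intro allI)
    fix A B
    show "pairing d (A \<otimes> B) = pairing f (circled_ast V0 A B)"
    proof (rule functional_eq_words[of "\<lambda>A. pairing d (A \<otimes> B)"])
      show "pairing d (word u \<otimes> B) = pairing f (circled_ast V0 (word u) B)" for u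
        by (rule functional_eq_words[of "\<lambda>B. pairing d (word u \<otimes> B)"];
            (intro functional_intros lin_intros)?)
          (simp add: pairing_single assms)
    qed (intro functional_intros lin_intros)+
  qed
next
  fix d' assume *: "\<forall>A B. pairing d' (A \<otimes> B) = pairing f (circled_ast V0 A B)"
  show "d' = d"
  proof (rule poly_mapping_eqI)
    show "Poly_Mapping.lookup d' k = Poly_Mapping.lookup d k" for k
      using * by (cases k) (metis assms pairing_single tensor_words)
  qed
qed

lemma pairing_word_left: "pairing (word w) f = Poly_Mapping.lookup f w"
  by (simp add: pairing_def word_def)

theorem theorem3p17:
  fixes V0 :: "letter set" and n :: nat and a :: "nat \<Rightarrow> letter"
  shows "Delta_I V0 (segment a 1 (n + 1)) =
    (\<Sum>k\<in>{0..n}. \<Sum>js\<in>index_seqs n k.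
       shuffle_list
         (map (\<lambda>p. I V0 (with_endpoints n a (idx n js p))
                        (segment a (idx n js p + 1) (idx n js (p + 1)))
                        (with_endpoints n a (idx n js (p + 1))))
              [0..<k + 1])
       \<otimes> word (map a js))"
proof (rule Delta_I_eqI)
  fix u v
  have *: "shuffle_list
         (map (\<lambda>p. I V0 (with_endpoints n a (idx n js p))
                        (segment a (idx n js p + 1) (idx n js (p + 1)))
                        (with_endpoints n a (idx n js (p + 1))))
              [0..<k + 1]) = gap_shuffle V0 a n Formal_outside 0 js"
    if "js \<in> index_seqs n k" for js k
  proof -
    have "set js \<subseteq> {1..n}" "k = length js"
      using that by (auto simp: index_seqs_def)
    moreover have "with_endpoints n a 0 = Formal_outside"
      by (simp add: with_endpoints_def)
    ultimately show ?thesis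
      using shuffle_list_eq_gap_shuffle[of js n V0 a 0] by (simp only: idx_def)
  qed
  have segment: "segment a 1 (n + 1) = word (map a [Suc 0..<Suc n])"
    by (simp add: segment_def del: upt_Suc)
  show "Poly_Mapping.lookup (\<Sum>k\<in>{0..n}. \<Sum>js\<in>index_seqs n k.
       shuffle_list
         (map (\<lambda>p. I V0 (with_endpoints n a (idx n js p))
                        (segment a (idx n js p + 1) (idx n js (p + 1)))
                        (with_endpoints n a (idx n js (p + 1))))
              [0..<k + 1])
       \<otimes> word (map a js)) (u, v) =
     pairing (segment a 1 (n + 1)) (circled_ast V0 (word u) (word v))"
    \<comment> \<open>The factor \<open>word (map a js)\<close> retains the index lists spelling
      \<open>v\<close>; for \<open>l = 0\<close> their sum is the coefficient of
      \<open>a\<^sub>1\<dots>a\<^sub>n\<close> in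
      \<open>circled_ast V0 (word u) (word v)\<close>.\<close>
    using lookup_gap_product[of V0 Formal_outside u v a 0 n]
    by (simp only: lookup_sum * lookup_tensor_word index_seqs_sum circled_ast_word pairing_word_left
        segment cong: sum.cong)
qed

end
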